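(* Let $v$ be a quadratic function (polynomial of degree at most two) on $\mathbb{R}^d$, and let $E_1,\dots,E_k$ be the eigenspaces of the (constant) Hessian of $v$, with corresponding distinct eigenvalues $\lambda_1,\dots,\lambda_k$. Let $\Omega\subset\mathbb{R}^d$ be a convex polyhedral domain with faces $\Sigma_1,\dots,\Sigma_m$ and outer unit normals $\nu_1,\dots,\nu_m$. (i) There exist constants $\mu,\gamma_1,\dots,\gamma_m\in\mathbb{R}$ with $\Delta v+\mu=0$ in $\Omega$ and $D_{\nu_j}v+\gamma_j=0$ on $\Sigma_j$ for $j=1,\dots,m$, if and only if $\Omega=\{x\in\mathbb{R}^d:\pi_{E_i}(x)\in\Omega_i,\ i=1,\dots,k\}$, where $\Omega_i$ is a convex polyhedral domain in $E_i$ for each $i$ and $\pi_{E_i}$ is the orthogonal projection onto $E_i$. (ii) $v$ satisfies $\Delta v+\mu=0$ in $\Omega$ for some constant $\mu$ and $D_\nu v=-1$ on $\partial\Omega$, if and only if $\Omega$ is of the form in (i) and, for each $i$, $\lambda_i<0$ and $\Omega_i$ is a circumsolid in $E_i$ with centre at the maximum point of $v|_{E_i}$ and radius $-1/\lambda_i$.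
   Context: A convex polyhedral domain in a Euclidean space $E$ is a (non-empty) bounded open set $\Omega=\bigcap_{i=1}^m\{x\in E: x\cdot\nu_i<b_i\}$ with unit vectors $\nu_i\in E$ and constants $b_i$, the description being minimal (omitting any half-space gives a strictly larger set). Its faces are $\Sigma_i=\{x\in\overline\Omega: x\cdot\nu_i=b_i\}$, with outer unit normal $\nu_i$. A convex polyhedral domain $\Omega$ in $E$ is a circumsolid with centre $x_0$ and radius $R>0$ if $B_R(x_0)\subset\overline\Omega$ and $\partial B_R(x_0)\cap\Sigma_i$ contains exactly one point for every $i$; equivalently $\Omega=\bigcap_{i=1}^m\{x\in E:(x-x_0)\cdot\nu_i<R\}$. *)

theory Defs
  imports "HOL-Analysis.Analysis"
begin

definition quadratic_function :: "(real ^ 'd \<Rightarrow> real) \<Rightarrow> bool" where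
  "quadratic_function v \<longleftrightarrow>
     (\<exists>(c::real) (b::real ^ 'd) (A::real ^ 'd ^ 'd). \<forall>x.
        v x = c + (\<Sum>i\<in>UNIV. b $ i * x $ i) + (\<Sum>i\<in>UNIV. \<Sum>j\<in>UNIV. A $ i $ j * x $ i * x $ j))"

definition dir_deriv :: "'a::real_normed_vector \<Rightarrow> ('a \<Rightarrow> real) \<Rightarrow> 'a \<Rightarrow> real" where
  "dir_deriv n v x = deriv (\<lambda>t::real. v (x + t *\<^sub>R n)) 0"

definition hessian :: "(real ^ 'd \<Rightarrow> real) \<Rightarrow> real ^ 'd \<Rightarrow> real ^ 'd ^ 'd" where
  "hessian v x = (\<chi> i j. dir_deriv (axis i 1) (dir_deriv (axis j 1) v) x)"

definition laplacian :: "(real ^ 'd \<Rightarrow> real) \<Rightarrow> real ^ 'd \<Rightarrow> real" where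
  "laplacian v x = (\<Sum>i\<in>UNIV. dir_deriv (axis i 1) (dir_deriv (axis i 1) v) x)"

definition eigenvalues :: "real ^ 'd ^ 'd \<Rightarrow> real set" where
  "eigenvalues H = {l. \<exists>w. w \<noteq> 0 \<and> H *v w = l *\<^sub>R w}"

definition eigenspace :: "real ^ 'd ^ 'd \<Rightarrow> real \<Rightarrow> (real ^ 'd) set" where
  "eigenspace H l = {w. H *v w = l *\<^sub>R w}"

definition orth_proj :: "'a::euclidean_space set \<Rightarrow> 'a \<Rightarrow> 'a" where
  "orth_proj E x = (THE y. y \<in> E \<and> (\<forall>z\<in>E. orthogonal (x - y) z))"

text \<open>
  The Euclidean space \<open>E\<close> is a linear subspace of an ambient Euclidean space, and topological
  notions are relative to \<open>E\<close>.  Since \<open>E\<close> is closed, the closure of a subset of \<open>E\<close> taken in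
  \<open>E\<close> is its closure in the ambient space.  The outer unit normals \<open>\<nu> j\<close> and constants
  \<open>b j\<close> are indexed by \<open>{1..m}\<close>; their values at other indices are irrelevant.
\<close>

definition polyhedral_description ::
    "'a::euclidean_space set \<Rightarrow> nat \<Rightarrow> (nat \<Rightarrow> 'a) \<Rightarrow> (nat \<Rightarrow> real) \<Rightarrow> 'a set \<Rightarrow> bool" where
  "polyhedral_description E m \<nu> b \<Omega> \<longleftrightarrow>
     subspace E \<and> \<Omega> \<noteq> {} \<and> bounded \<Omega> \<and> openin (top_of_set E) \<Omega> \<and>
     (\<forall>j\<in>{1..m}. \<nu> j \<in> E \<and> norm (\<nu> j) = 1) \<and>
     \<Omega> = {x\<in>E. \<forall>j\<in>{1..m}. x \<bullet> \<nu> j < b j} \<and>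
     (\<forall>i\<in>{1..m}. \<Omega> \<subset> {x\<in>E. \<forall>j\<in>{1..m} - {i}. x \<bullet> \<nu> j < b j})"

definition convex_polyhedral_domain :: "'a::euclidean_space set \<Rightarrow> 'a set \<Rightarrow> bool" where
  "convex_polyhedral_domain E \<Omega> \<longleftrightarrow> (\<exists>m \<nu> b. polyhedral_description E m \<nu> b \<Omega>)"

definition polyhedral_face :: "'a::euclidean_space set \<Rightarrow> 'a \<Rightarrow> real \<Rightarrow> 'a set" where
  "polyhedral_face \<Omega> n c = {x \<in> closure \<Omega>. x \<bullet> n = c}"

definition circumsolid :: "'a::euclidean_space set \<Rightarrow> 'a \<Rightarrow> real \<Rightarrow> 'a set \<Rightarrow> bool" where
  "circumsolid E x0 R \<Omega> \<longleftrightarrow>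
     x0 \<in> E \<and> R > 0 \<and>
     (\<exists>m \<nu> b. polyhedral_description E m \<nu> b \<Omega> \<and>
        ball x0 R \<inter> E \<subseteq> closure \<Omega> \<and>
        (\<forall>j\<in>{1..m}. \<exists>!p. p \<in> (sphere x0 R \<inter> E) \<inter> polyhedral_face \<Omega> (\<nu> j) (b j)))"

end

theory Submission
  imports Defs
begin

text \<open>
  Write \<open>\<nabla>v(x) = H x + g\<close>. The derivative \<open>D\<^bsub>\<nu>\<^esub>v\<close> is constant on a facet with normal \<open>\<nu>\<close> iff
  \<open>H \<nu>\<close> is parallel to \<open>\<nu>\<close>, so the Neumann condition says that every normal is an eigenvector of \<open>H\<close>.
  Grouping the half-spaces by eigenspace then gives the product structure. Conversely the facet
  normals of a product lie in the factors, because near a relative interior point of a facet the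
  domain is a half-space. On a facet with normal in the eigenspace of \<open>\<lambda>\<close>, the value \<open>-1\<close> means
  \<open>\<lambda> b + g \<bullet> \<nu> = -1\<close>. If \<open>\<lambda> \<ge> 0\<close>, then \<open>\<lambda> y + \<pi> g\<close>, for any \<open>y\<close> in the factor, is a recession
  direction, which contradicts boundedness; if \<open>\<lambda> < 0\<close>, the equation places the facet at distance
  \<open>-1/\<lambda>\<close> from the critical point \<open>- \<pi> g / \<lambda>\<close>. The spectral theorem is not needed: orthogonality of
  distinct eigenspaces suffices.
\<close>

section \<open>Quadratic functions\<close>

lemma dir_deriv_eqI:
  assumes "((\<lambda>t::real. f (x + t *\<^sub>R n)) has_real_derivative D) (at 0)"
  shows "dir_deriv n f x = D"
  using DERIV_imp_deriv[OF assms] by (simp add: dir_deriv_def)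

lemma dir_deriv_of_expansion:
  fixes f :: "'a::real_normed_vector \<Rightarrow> real"
  assumes "\<And>t. f (x + t *\<^sub>R n) = a + t * p + t\<^sup>2 * q"
  shows "dir_deriv n f x = p"
proof (rule dir_deriv_eqI)
  show "((\<lambda>t. f (x + t *\<^sub>R n)) has_real_derivative p) (at 0)"
    unfolding assms by (auto intro!: derivative_eq_intros)
qed

text \<open>Second-order expansion along lines, exact because \<open>v\<close> has degree at most
  two. It exhibits \<open>H *v x + g\<close> as the gradient and yields the symmetry of
  \<open>H\<close>.\<close>

lemma quadratic_function_expansion:
  fixes v :: "real ^ 'd \<Rightarrow> real"
  assumes v: "quadratic_function v" and H: "\<And>x. hessian v x = H"
  obtains g where
    "\<And>x n t. v (x + t *\<^sub>R n) = v x + t * ((H *v x + g) \<bullet> n) + t\<^sup>2 * (n \<bullet> (H *v n) / 2)"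
    "\<And>x y. (H *v x) \<bullet> y = x \<bullet> (H *v y)"
proof -
  obtain c g and A :: "real ^ 'd ^ 'd" where v_coord:
    "\<And>x. v x = c + (\<Sum>i\<in>UNIV. g $ i * x $ i) + (\<Sum>i\<in>UNIV. \<Sum>j\<in>UNIV. A $ i $ j * x $ i * x $ j)"
    using v unfolding quadratic_function_def by blast
  have v_eq: "v x = c + g \<bullet> x + x \<bullet> (A *v x)" for x
    by (simp add: v_coord inner_vec_def matrix_vector_mult_def sum_distrib_left algebra_simps)
  have expand: "v (x + t *\<^sub>R n) = v x + t * (g \<bullet> n + x \<bullet> (A *v n) + n \<bullet> (A *v x))
      + t\<^sup>2 * (n \<bullet> (A *v n))" for x n t
    by (simp add: v_eq matrix_vector_right_distrib matrix_vector_mult_scaleR inner_simps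
        algebra_simps power2_eq_square)
  have grad: "dir_deriv n v x = g \<bullet> n + x \<bullet> (A *v n) + n \<bullet> (A *v x)" for x n
    by (rule dir_deriv_of_expansion[OF expand])
  \<comment> \<open>The first derivative is affine in the base point, hence the quadratic
    coefficient 0.\<close>
  have second: "dir_deriv n' (dir_deriv n v) x = n' \<bullet> (A *v n) + n \<bullet> (A *v n')" for x n n'
    by (rule dir_deriv_of_expansion[where a = "dir_deriv n v x" and q = 0])
      (simp add: grad matrix_vector_right_distrib matrix_vector_mult_scaleR inner_simps algebra_simps)
  \<comment> \<open>\<open>A\<close> may be non-symmetric; differentiating twice symmetrizes
    it.\<close>
  have "H = A + transpose A"
    unfolding H[of 0, symmetric] hessian_def
    by (simp add: vec_eq_iff second inner_axis' matrix_vector_mul_component inner_axis transpose_def)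
  then have H_mult: "(H *v x) \<bullet> y = x \<bullet> (A *v y) + y \<bullet> (A *v x)" for x y
    by (simp add: matrix_vector_mult_add_rdistrib inner_simps dot_lmul_matrix[symmetric]
        inner_commute)
  show thesis
  proof
    show "v (x + t *\<^sub>R n) = v x + t * ((H *v x + g) \<bullet> n) + t\<^sup>2 * (n \<bullet> (H *v n) / 2)" for x n t
      by (simp add: expand inner_add_left H_mult inner_commute[of n "H *v n"])
    show "(H *v x) \<bullet> y = x \<bullet> (H *v y)" for x y
      by (simp add: H_mult inner_commute[of x "H *v y"])
  qed
qed

lemma laplacian_eq_trace_hessian: "laplacian v x = (\<Sum>i\<in>UNIV. hessian v x $ i $ i)"
  by (simp add: laplacian_def hessian_def)

lemma subspace_eigenspace: "subspace (eigenspace H l)"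
  by (auto simp: subspace_def eigenspace_def matrix_vector_right_distrib
      matrix_vector_mult_scaleR scaleR_add_right)

text \<open>Moving \<open>H\<close> across the inner product gives
  \<open>l * (x \<bullet> y) = l' * (x \<bullet> y)\<close>.\<close>

lemma orthogonal_eigenspaces:
  assumes sym: "\<And>x y. (H *v x) \<bullet> y = x \<bullet> (H *v y)"
    and "x \<in> eigenspace H l" "y \<in> eigenspace H l'" "l \<noteq> l'"
  shows "x \<bullet> y = 0"
  using sym[of x y] assms(2-) by (simp add: eigenspace_def)

section \<open>Orthogonal projections\<close>

text \<open>The description operator needs unique existence: the difference of two candidates lies
  in \<open>E\<close> and is orthogonal to itself.\<close>

lemma orth_proj:
  fixes E :: "'a::euclidean_space set"
  assumes "subspace E"
  shows orth_proj_mem: "orth_proj E x \<in> E"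
    and orth_proj_inner: "z \<in> E \<Longrightarrow> orth_proj E x \<bullet> z = x \<bullet> z"
proof -
  obtain y u where y: "y \<in> span E" "\<And>w. w \<in> span E \<Longrightarrow> orthogonal u w" and x: "x = y + u"
    using orthogonal_subspace_decomp_exists by blast
  have span: "span E = E"
    using assms by (simp add: span_eq_iff)
  have "\<exists>!y. y \<in> E \<and> (\<forall>z\<in>E. orthogonal (x - y) z)"
  proof (rule ex1I)
    show "y \<in> E \<and> (\<forall>z\<in>E. orthogonal (x - y) z)"
      using y x span by auto
    fix y' assume y': "y' \<in> E \<and> (\<forall>z\<in>E. orthogonal (x - y') z)"
    then have "y' - y \<in> E"
      using y span assms by (auto intro: subspace_diff)
    then have "orthogonal (x - y) (y' - y)" "orthogonal (x - y') (y' - y)"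
      using y y' x span by auto
    then have "(y' - y) \<bullet> (y' - y) = 0"
      by (simp add: orthogonal_def inner_simps)
    then show "y' = y"
      by simp
  qed
  from theI'[OF this] have *: "orth_proj E x \<in> E \<and> (\<forall>z\<in>E. orthogonal (x - orth_proj E x) z)"
    unfolding orth_proj_def .
  then show "orth_proj E x \<in> E" "z \<in> E \<Longrightarrow> orth_proj E x \<bullet> z = x \<bullet> z"
    by (auto simp: orthogonal_def inner_diff_left)
qed

section \<open>Polyhedral domains\<close>

lemma polyhedral_descriptionD:
  assumes "polyhedral_description E m \<nu> b \<Omega>"
  shows "subspace E" "\<Omega> \<noteq> {}" "bounded \<Omega>" "\<And>j. j \<in> {1..m} \<Longrightarrow> \<nu> j \<in> E"
    "\<And>j. j \<in> {1..m} \<Longrightarrow> norm (\<nu> j) = 1" "\<Omega> = {x\<in>E. \<forall>j\<in>{1..m}. x \<bullet> \<nu> j < b j}"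
    "\<And>i. i \<in> {1..m} \<Longrightarrow> \<Omega> \<subset> {x\<in>E. \<forall>j\<in>{1..m} - {i}. x \<bullet> \<nu> j < b j}"
  using assms unfolding polyhedral_description_def by blast+

lemma polyhedral_memD:
  assumes "polyhedral_description E m \<nu> b \<Omega>" "x \<in> \<Omega>" "j \<in> {1..m}"
  shows "x \<bullet> \<nu> j < b j"
  using assms polyhedral_descriptionD(6)[OF assms(1)] by blast

lemma polyhedral_memI:
  assumes desc: "polyhedral_description E m \<nu> b \<Omega>"
    and "x \<in> E" "x \<bullet> \<nu> j < b j" "\<And>l. l \<in> {1..m} - {j} \<Longrightarrow> x \<bullet> \<nu> l < b l"
  shows "x \<in> \<Omega>"
proof -
  have "x \<bullet> \<nu> l < b l" if "l \<in> {1..m}" for l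
    using assms(3,4) that by (cases "l = j") auto
  then show ?thesis
    using assms(2) by (subst polyhedral_descriptionD(6)[OF desc]) blast
qed

text \<open>A factor inherits a subset of the half-spaces, while a description is indexed by an
  initial segment of the naturals. Reindexing along a bijection keeps minimality, since deleting a
  position then deletes exactly one half-space.\<close>

lemma polyhedral_description_finite_index:
  fixes \<nu> :: "'i \<Rightarrow> 'a::euclidean_space"
  assumes "finite J" "subspace E" "\<Omega> \<noteq> {}" "bounded \<Omega>" "\<And>j. j \<in> J \<Longrightarrow> \<nu> j \<in> E \<and> norm (\<nu> j) = 1"
    and \<Omega>: "\<Omega> = {x\<in>E. \<forall>j\<in>J. x \<bullet> \<nu> j < b j}"
    and minimal: "\<And>i. i \<in> J \<Longrightarrow> \<exists>x\<in>E. x \<notin> \<Omega> \<and> (\<forall>j\<in>J - {i}. x \<bullet> \<nu> j < b j)"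
  obtains M f where "f ` {1..M} = J" "polyhedral_description E M (\<nu> \<circ> f) (b \<circ> f) \<Omega>"
proof -
  obtain f where f: "bij_betw f {1..card J} J"
    using ex_bij_betw_nat_finite_1[OF \<open>finite J\<close>] by blast
  then have image: "f ` {1..card J} = J" and inj: "inj_on f {1..card J}"
    by (auto simp: bij_betw_def)
  have ball_image: "f ` A = B \<Longrightarrow> (\<forall>l\<in>A. P (f l)) \<longleftrightarrow> (\<forall>j\<in>B. P j)" for A B P
    by auto
  have ball_minus: "(\<forall>l\<in>{1..card J} - {i}. P (f l)) \<longleftrightarrow> (\<forall>j\<in>J - {f i}. P j)"
    if "i \<in> {1..card J}" for P i
  proof -
    have "f ` ({1..card J} - {i}) = J - {f i}"
      using inj_on_image_set_diff[OF inj, of "{1..card J}" "{i}"] that image by auto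
    then show ?thesis
      by (rule ball_image)
  qed
  have "open (\<Inter>j\<in>J. {x. x \<bullet> \<nu> j < b j})"
    using \<open>finite J\<close> by (auto intro!: open_INT simp: inner_commute[of _ "\<nu> _"] open_halfspace_lt)
  moreover have "\<Omega> = E \<inter> (\<Inter>j\<in>J. {x. x \<bullet> \<nu> j < b j})"
    using \<Omega> by auto
  ultimately have "openin (top_of_set E) \<Omega>"
    by (auto simp: openin_open)
  moreover have "\<Omega> \<subset> {x\<in>E. \<forall>l\<in>{1..card J} - {i}. x \<bullet> \<nu> (f l) < b (f l)}"
    if "i \<in> {1..card J}" for i
  proof -
    have "f i \<in> J"
      using that image by blast
    then obtain x where "x \<in> E" "x \<notin> \<Omega>" "\<forall>j\<in>J - {f i}. x \<bullet> \<nu> j < b j"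
      using minimal by blast
    moreover have "\<Omega> \<subseteq> {x\<in>E. \<forall>j\<in>J - {f i}. x \<bullet> \<nu> j < b j}"
      using \<Omega> by auto
    ultimately show ?thesis
      using ball_minus[OF that, of "\<lambda>j. _ \<bullet> \<nu> j < b j"] by blast
  qed
  ultimately have "polyhedral_description E (card J) (\<nu> \<circ> f) (b \<circ> f) \<Omega>"
    unfolding polyhedral_description_def
    using assms ball_image[OF image, of "\<lambda>j. \<nu> j \<in> E \<and> norm (\<nu> j) = 1"] ball_image[OF image, of "\<lambda>j. _ \<bullet> \<nu> j < b j"]
    by simp
  then show thesis
    using that image by blast
qed

text \<open>A point satisfying the weak inequalities is the end of a segment from a point of
  \<open>\<Omega>\<close>. The open segment satisfies them strictly, so it lies in
  \<open>\<Omega>\<close>.\<close>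

lemma closure_polyhedral:
  assumes desc: "polyhedral_description E m \<nu> b \<Omega>"
  shows "closure \<Omega> = {x\<in>E. \<forall>j\<in>{1..m}. x \<bullet> \<nu> j \<le> b j}" (is "_ = ?C")
proof
  note D = polyhedral_descriptionD[OF desc]
  have "?C = E \<inter> (\<Inter>j\<in>{1..m}. {x. \<nu> j \<bullet> x \<le> b j})"
    by (auto simp: inner_commute)
  then have "closed ?C"
    using closed_subspace[OF D(1)] by (auto intro!: closed_INT simp: closed_halfspace_le)
  then show "closure \<Omega> \<subseteq> ?C"
    by (intro closure_minimal) (auto simp: D(6) less_imp_le)
  show "?C \<subseteq> closure \<Omega>"
  proof
    fix x assume x: "x \<in> ?C"
    obtain z where z: "z \<in> \<Omega>"
      using D(2) by blast
    have "open_segment z x \<subseteq> \<Omega>"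
    proof
      fix y assume "y \<in> open_segment z x"
      then obtain u where u: "0 < u" "u < 1" "y = (1 - u) *\<^sub>R z + u *\<^sub>R x"
        by (auto simp: in_segment)
      have "y \<bullet> \<nu> j < b j" if "j \<in> {1..m}" for j
      proof -
        have "(1 - u) * (z \<bullet> \<nu> j) + u * (x \<bullet> \<nu> j) < (1 - u) * b j + u * b j"
          using z x u that by (intro add_less_le_mono mult_strict_left_mono mult_left_mono) (auto simp: D(6))
        then show ?thesis
          by (simp add: u(3) inner_simps algebra_simps)
      qed
      moreover have "y \<in> E"
        using z x u D(1) by (auto simp: D(6) intro!: subspace_add subspace_scale)
      ultimately show "y \<in> \<Omega>"
        by (auto simp: D(6))
    qed
    then have "closure (open_segment z x) \<subseteq> closure \<Omega>"
      by (rule closure_mono)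
    then show "x \<in> closure \<Omega>"
      using z closure_subset by (cases "z = x") (auto simp: closure_open_segment)
  qed
qed

lemma polyhedral_faceI:
  assumes desc: "polyhedral_description E m \<nu> b \<Omega>"
    and "x \<in> E" "x \<bullet> \<nu> j = b j" "\<And>l. l \<in> {1..m} - {j} \<Longrightarrow> x \<bullet> \<nu> l < b l"
  shows "x \<in> polyhedral_face \<Omega> (\<nu> j) (b j)"
proof -
  have "x \<bullet> \<nu> l \<le> b l" if "l \<in> {1..m}" for l
    using assms(3,4) that by (cases "l = j") (auto intro: less_imp_le)
  then show ?thesis
    using assms(2,3) by (auto simp: polyhedral_face_def closure_polyhedral[OF desc])
qed

text \<open>Produces a relative interior point of the face. By minimality some \<open>y\<close>
  violates only inequality \<open>j\<close>; the segment to \<open>y\<close> from a point of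
  \<open>\<Omega>\<close> crosses the hyperplane \<open>j\<close> while all other inequalities stay
  strict.\<close>

lemma facet_point:
  assumes desc: "polyhedral_description E m \<nu> b \<Omega>" and j: "j \<in> {1..m}"
  obtains x where "x \<in> E" "x \<bullet> \<nu> j = b j" "\<And>l. l \<in> {1..m} - {j} \<Longrightarrow> x \<bullet> \<nu> l < b l"
proof -
  note D = polyhedral_descriptionD[OF desc]
  obtain z where z: "z \<in> E" "\<And>l. l \<in> {1..m} \<Longrightarrow> z \<bullet> \<nu> l < b l"
    using D(2,6) by blast
  obtain y where y: "y \<in> E" "y \<notin> \<Omega>" "\<And>l. l \<in> {1..m} - {j} \<Longrightarrow> y \<bullet> \<nu> l < b l"
    using D(7)[OF j] by blast
  then have "b j \<le> y \<bullet> \<nu> j"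
    using polyhedral_memI[OF desc, of y j] by force
  moreover have "z \<bullet> \<nu> j < b j"
    using z j by blast
  \<comment> \<open>The parameter at which the segment from \<open>z\<close> to \<open>y\<close>
    meets the hyperplane; it is 1 when \<open>y\<close> already lies there.\<close>
  moreover define u where "u = (b j - z \<bullet> \<nu> j) / (y \<bullet> \<nu> j - z \<bullet> \<nu> j)"
  ultimately have u: "0 < u" "u \<le> 1" "u * (y \<bullet> \<nu> j - z \<bullet> \<nu> j) = b j - z \<bullet> \<nu> j"
    by (simp_all add: u_def)
  show thesis
  proof
    show "(1 - u) *\<^sub>R z + u *\<^sub>R y \<in> E"
      using z y D(1) by (auto intro!: subspace_add subspace_scale)
    show "((1 - u) *\<^sub>R z + u *\<^sub>R y) \<bullet> \<nu> j = b j"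
      using u(3) by (simp add: inner_simps algebra_simps)
    show "((1 - u) *\<^sub>R z + u *\<^sub>R y) \<bullet> \<nu> l < b l" if "l \<in> {1..m} - {j}" for l
    proof -
      have "(1 - u) * (z \<bullet> \<nu> l) + u * (y \<bullet> \<nu> l) < (1 - u) * b l + u * b l"
        using z y u that by (intro add_le_less_mono mult_strict_left_mono mult_left_mono) (auto intro: less_imp_le)
      then show ?thesis
        by (simp add: inner_simps algebra_simps)
    qed
  qed
qed

lemma perturb_strict_inequalities:
  fixes x h :: "'a::real_inner"
  assumes "finite J" "\<And>l. l \<in> J \<Longrightarrow> x \<bullet> \<nu> l < b l"
  obtains t :: real where "0 < t" "\<And>l. l \<in> J \<Longrightarrow> (x + t *\<^sub>R h) \<bullet> \<nu> l < b l"
proof -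
  have "\<forall>\<^sub>F t in at_right 0. (x + t *\<^sub>R h) \<bullet> \<nu> l < b l" if "l \<in> J" for l
  proof (rule order_tendstoD)
    have "((\<lambda>t. (x + t *\<^sub>R h) \<bullet> \<nu> l) \<longlongrightarrow> (x + 0 *\<^sub>R h) \<bullet> \<nu> l) (at_right 0)"
      by (intro tendsto_intros)
    then show "((\<lambda>t. (x + t *\<^sub>R h) \<bullet> \<nu> l) \<longlongrightarrow> x \<bullet> \<nu> l) (at_right 0)"
      by simp
  qed (use assms that in auto)
  then have "\<forall>\<^sub>F t in at_right 0. \<forall>l\<in>J. (x + t *\<^sub>R h) \<bullet> \<nu> l < b l"
    using \<open>finite J\<close> by (simp add: eventually_ball_finite)
  moreover have "\<forall>\<^sub>F t::real in at_right 0. 0 < t"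
    by (simp add: eventually_at_right_less)
  ultimately have "\<forall>\<^sub>F t in at_right 0. 0 < t \<and> (\<forall>l\<in>J. (x + t *\<^sub>R h) \<bullet> \<nu> l < b l)"
    by eventually_elim simp
  then show thesis
    using that eventually_happens' trivial_limit_at_right_real by blast
qed

text \<open>Some half-space of the second description is tight at a relative interior point of the
  face. Every direction entering half-space \<open>j\<close> there enters \<open>\<Omega>\<close>,
  hence also the tight half-space; for unit normals this inclusion forces equality.\<close>

lemma facet_normal_of_other_description:
  fixes \<nu> :: "nat \<Rightarrow> 'a::euclidean_space"
  assumes desc: "polyhedral_description UNIV m \<nu> b \<Omega>" and j: "j \<in> {1..m}"
    and \<Omega>: "\<Omega> = {x. \<forall>k\<in>K. x \<bullet> n k < c k}" and n: "\<And>k. k \<in> K \<Longrightarrow> norm (n k) = 1"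
  obtains k where "k \<in> K" "\<nu> j = n k" "b j = c k"
proof -
  note D = polyhedral_descriptionD[OF desc]
  obtain x where x: "x \<bullet> \<nu> j = b j" "\<And>l. l \<in> {1..m} - {j} \<Longrightarrow> x \<bullet> \<nu> l < b l"
    using facet_point[OF desc j] by metis
  \<comment> \<open>Lying outside \<open>\<Omega>\<close> gives a violated inequality
    \<open>k\<close>, and lying in the closure turns it into an equality.\<close>
  have "x \<notin> \<Omega>"
    using x(1) polyhedral_memD[OF desc _ j, of x] by auto
  then obtain k where k: "k \<in> K" "c k \<le> x \<bullet> n k"
    by (auto simp: \<Omega> not_less)
  have "x \<in> closure \<Omega>"
    using polyhedral_faceI[OF desc _ x] by (simp add: polyhedral_face_def)
  moreover have "closure \<Omega> \<subseteq> {y. n k \<bullet> y \<le> c k}"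
    using k(1) by (intro closure_minimal closed_halfspace_le) (auto simp: \<Omega> inner_commute less_imp_le)
  ultimately have xk: "x \<bullet> n k = c k"
    using k(2) by (auto simp: inner_commute)
  have inward: "h \<bullet> n k < 0" if h: "h \<bullet> \<nu> j < 0" for h
  proof -
    obtain t where t: "0 < t" "\<And>l. l \<in> {1..m} - {j} \<Longrightarrow> (x + t *\<^sub>R h) \<bullet> \<nu> l < b l"
      using perturb_strict_inequalities[of "{1..m} - {j}" x \<nu> b h] x(2) by blast
    moreover have "(x + t *\<^sub>R h) \<bullet> \<nu> j < b j"
      using x(1) h t(1) by (simp add: inner_simps mult_less_0_iff)
    ultimately have "x + t *\<^sub>R h \<in> \<Omega>"
      by (intro polyhedral_memI[OF desc, where j = j]) simp_all
    then have "(x + t *\<^sub>R h) \<bullet> n k < c k"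
      using k(1) by (auto simp: \<Omega>)
    then show ?thesis
      using xk t(1) by (simp add: inner_simps mult_less_0_iff)
  qed
  have units: "\<nu> j \<bullet> \<nu> j = 1" "n k \<bullet> n k = 1"
    using D(5)[OF j] n[OF k(1)] by (simp_all add: norm_eq_1)
  have "n k = \<nu> j"
  proof (rule ccontr)
    assume "n k \<noteq> \<nu> j"
    then have "0 < (n k - \<nu> j) \<bullet> (n k - \<nu> j)"
      by simp
    then have "n k \<bullet> \<nu> j < 1"
      using units by (simp add: inner_simps inner_commute)
    \<comment> \<open>The direction \<open>n k - \<nu> j\<close> points strictly inward for
      \<open>\<nu> j\<close> but strictly outward for \<open>n k\<close>.\<close>
    then show False
      using inward[of "n k - \<nu> j"] units by (simp add: inner_simps inner_commute)
  qed
  then show thesis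
    using that k(1) x(1) xk by metis
qed

text \<open>A ray from a point of \<open>\<Omega>\<close> in direction \<open>w\<close> never leaves
  \<open>\<Omega>\<close>, which is bounded.\<close>

lemma no_recession_direction:
  assumes desc: "polyhedral_description E m \<nu> b \<Omega>"
    and w: "w \<in> E" "\<And>j. j \<in> {1..m} \<Longrightarrow> w \<bullet> \<nu> j \<le> 0"
  shows "w = 0"
proof (rule ccontr)
  assume "w \<noteq> 0"
  note D = polyhedral_descriptionD[OF desc]
  obtain z where z: "z \<in> \<Omega>"
    using D(2) by blast
  obtain B where B: "\<And>x. x \<in> \<Omega> \<Longrightarrow> norm x \<le> B"
    using D(3) by (auto simp: bounded_iff)
  \<comment> \<open>Chosen so that the step length exceeds \<open>B + norm z\<close>, the bound that
    the triangle inequality would impose.\<close>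
  define t where "t = (B + norm z + 1) / norm w"
  have "0 \<le> B"
    using B[OF z] norm_ge_zero[of z] by linarith
  then have t: "0 \<le> t" "t * norm w = B + norm z + 1"
    using \<open>w \<noteq> 0\<close> by (auto simp: t_def)
  have "(z + t *\<^sub>R w) \<bullet> \<nu> j < b j" if "j \<in> {1..m}" for j
  proof -
    have "t * (w \<bullet> \<nu> j) \<le> 0" "z \<bullet> \<nu> j < b j"
      using w(2)[OF that] t(1) z that by (auto simp: D(6) mult_le_0_iff)
    then show ?thesis
      by (simp add: inner_simps)
  qed
  then have "z + t *\<^sub>R w \<in> \<Omega>"
    using z w(1) D(1) by (auto simp: D(6) subspace_add subspace_scale)
  then have "norm (z + t *\<^sub>R w) \<le> B"
    by (rule B)
  moreover have "norm (t *\<^sub>R w) \<le> norm (z + t *\<^sub>R w) + norm z"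
    using norm_triangle_ineq4[of "z + t *\<^sub>R w" z] by simp
  ultimately show False
    using t by simp
qed

text \<open>A linear functional constant on a face has no component tangential to it: the face
  contains a small step from a relative interior point in the direction of that component.\<close>

lemma normal_constant_on_facet:
  fixes \<nu> :: "nat \<Rightarrow> 'a::euclidean_space"
  assumes desc: "polyhedral_description UNIV m \<nu> b \<Omega>" and j: "j \<in> {1..m}"
    and const: "\<And>x. x \<in> polyhedral_face \<Omega> (\<nu> j) (b j) \<Longrightarrow> x \<bullet> u = a"
  shows "u = (u \<bullet> \<nu> j) *\<^sub>R \<nu> j"
proof -
  note D = polyhedral_descriptionD[OF desc]
  obtain x where x: "x \<bullet> \<nu> j = b j" "\<And>l. l \<in> {1..m} - {j} \<Longrightarrow> x \<bullet> \<nu> l < b l"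
    using facet_point[OF desc j] by metis
  define h where "h = u - (u \<bullet> \<nu> j) *\<^sub>R \<nu> j"
  have h: "h \<bullet> \<nu> j = 0"
    using D(5)[OF j] by (simp add: h_def inner_simps norm_eq_1)
  obtain t where t: "0 < t" "\<And>l. l \<in> {1..m} - {j} \<Longrightarrow> (x + t *\<^sub>R h) \<bullet> \<nu> l < b l"
    using perturb_strict_inequalities[of "{1..m} - {j}" x \<nu> b h] x(2) by blast
  have "x \<bullet> u = a" "(x + t *\<^sub>R h) \<bullet> u = a"
    using x t(2) h by (intro const polyhedral_faceI[OF desc]; simp add: inner_add_left)+
  then have "h \<bullet> u = 0"
    using t(1) by (simp add: inner_simps)
  then have "h \<bullet> h = 0"
    using h by (simp add: h_def inner_simps)
  then show ?thesis
    by (simp add: h_def)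
qed

section \<open>Products along orthogonal subspaces\<close>

text \<open>Projecting to \<open>E i\<close> preserves inner products with vectors of
  \<open>E i\<close>, so the product is the intersection of all half-spaces of its factors, and the
  comparison of descriptions applies with pairs as indices.\<close>

lemma facet_normal_of_product:
  fixes E :: "'i \<Rightarrow> 'a::euclidean_space set"
  assumes desc: "polyhedral_description UNIV m \<nu> b \<Omega>" and j: "j \<in> {1..m}"
    and W: "\<And>i. i \<in> I \<Longrightarrow> polyhedral_description (E i) (M i) (n i) (c i) (W i)"
    and \<Omega>: "\<Omega> = {x. \<forall>i\<in>I. orth_proj (E i) x \<in> W i}"
  obtains i l where "i \<in> I" "l \<in> {1..M i}" "\<nu> j = n i l" "b j = c i l"
proof -
  let ?K = "Sigma I (\<lambda>i. {1..M i})"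
  have "orth_proj (E i) x \<in> W i \<longleftrightarrow> (\<forall>l\<in>{1..M i}. x \<bullet> n i l < c i l)" if "i \<in> I" for i x
  proof -
    note D = polyhedral_descriptionD[OF W[OF that]]
    show ?thesis
      using D(4) by (subst D(6)) (auto simp: orth_proj[OF D(1)])
  qed
  then have "\<Omega> = {x. \<forall>k\<in>?K. x \<bullet> n (fst k) (snd k) < c (fst k) (snd k)}"
    unfolding \<Omega> by auto
  moreover have "norm (n (fst k) (snd k)) = 1" if "k \<in> ?K" for k
    using that polyhedral_descriptionD(5)[OF W] by auto
  ultimately obtain k where "k \<in> ?K" "\<nu> j = n (fst k) (snd k)" "b j = c (fst k) (snd k)"
    by (rule facet_normal_of_other_description[OF desc j])
  then show thesis
    using that by auto
qed

text \<open>Grouping the half-spaces by the subspace containing their normals. By orthogonality, a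
  change of the component in \<open>E i\<close> affects only the inequalities of group
  \<open>i\<close>.\<close>

lemma
  fixes E :: "'i \<Rightarrow> 'a::euclidean_space set"
  assumes desc: "polyhedral_description UNIV m \<nu> b \<Omega>"
    and E: "\<And>i. i \<in> I \<Longrightarrow> subspace (E i)"
    and orth: "\<And>i i' x y. \<lbrakk>i \<in> I; i' \<in> I; i \<noteq> i'; x \<in> E i; y \<in> E i'\<rbrakk> \<Longrightarrow> x \<bullet> y = 0"
    and normals: "\<And>j. j \<in> {1..m} \<Longrightarrow> \<exists>i\<in>I. \<nu> j \<in> E i"
    and W: "\<And>i. W i = {y \<in> E i. \<forall>j\<in>{1..m}. \<nu> j \<in> E i \<longrightarrow> y \<bullet> \<nu> j < b j}"
  shows product_of_factors: "\<Omega> = {x. \<forall>i\<in>I. orth_proj (E i) x \<in> W i}"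
    and polyhedral_factor: "i \<in> I \<Longrightarrow> \<exists>M f. f ` {1..M} = {j\<in>{1..m}. \<nu> j \<in> E i} \<and>
      polyhedral_description (E i) M (\<nu> \<circ> f) (b \<circ> f) (W i)"
proof -
  note D = polyhedral_descriptionD[OF desc]
  have proj_W: "orth_proj (E i) x \<in> W i \<longleftrightarrow> (\<forall>j\<in>{1..m}. \<nu> j \<in> E i \<longrightarrow> x \<bullet> \<nu> j < b j)"
    if "i \<in> I" for i x
    by (auto simp: W orth_proj[OF E[OF that]])
  then show \<Omega>: "\<Omega> = {x. \<forall>i\<in>I. orth_proj (E i) x \<in> W i}"
    using normals by (simp add: D(6) set_eq_iff del: atLeastAtMost_iff One_nat_def) blast
  assume i: "i \<in> I"
  obtain x0 where x0: "x0 \<in> \<Omega>"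
    using D(2) by blast
  \<comment> \<open>Adding \<open>?q\<close> to a point of \<open>W i\<close> replaces the
    \<open>E i\<close> component of \<open>x0\<close>. This embeds a translate of \<open>W i\<close>
    in \<open>\<Omega>\<close>, whence boundedness.\<close>
  let ?q = "x0 - orth_proj (E i) x0"
  have "y + ?q \<in> \<Omega>" if y: "y \<in> W i" for y
  proof -
    have "(y + ?q) \<bullet> \<nu> j < b j" if j: "j \<in> {1..m}" for j
    proof (cases "\<nu> j \<in> E i")
      case True
      then show ?thesis
        using y j by (auto simp: W inner_simps orth_proj[OF E[OF i]])
    next
      case False
      then obtain i' where "i' \<in> I" "i \<noteq> i'" "\<nu> j \<in> E i'"
        using normals[OF j] by metis
      then have "y \<bullet> \<nu> j = 0" "orth_proj (E i) x0 \<bullet> \<nu> j = 0"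
        using y orth[OF i _ _ _ \<open>\<nu> j \<in> E i'\<close>] orth_proj_mem[OF E[OF i]] by (auto simp: W)
      then show ?thesis
        using x0 j by (auto simp: D(6) inner_simps)
    qed
    then show ?thesis
      by (auto simp: D(6))
  qed
  then have "W i \<subseteq> (\<lambda>x. x - ?q) ` \<Omega>"
    by (auto intro!: image_eqI[where x = "_ + ?q"])
  then have bounded: "bounded (W i)"
    using D(3) bounded_subset bounded_translation_minus by blast
  \<comment> \<open>The witness is the projection of a relative interior point of face
    \<open>j\<close>: equality in \<open>j\<close>, strict inequality in the rest of the
    group.\<close>
  have minimal: "\<exists>y\<in>E i. y \<notin> W i \<and> (\<forall>l\<in>{l\<in>{1..m}. \<nu> l \<in> E i} - {j}. y \<bullet> \<nu> l < b l)"
    if j: "j \<in> {j\<in>{1..m}. \<nu> j \<in> E i}" for j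
  proof -
    obtain x where x: "x \<bullet> \<nu> j = b j" "\<And>l. l \<in> {1..m} - {j} \<Longrightarrow> x \<bullet> \<nu> l < b l"
      using facet_point[OF desc] j by (metis (lifting) mem_Collect_eq)
    then show ?thesis
      using j by (intro bexI[where x = "orth_proj (E i) x"]) (auto simp: W orth_proj[OF E[OF i]])
  qed
  have nonempty: "W i \<noteq> {}"
    using x0 i \<Omega> by auto
  have W_eq: "W i = {y\<in>E i. \<forall>j\<in>{j\<in>{1..m}. \<nu> j \<in> E i}. y \<bullet> \<nu> j < b j}"
    by (auto simp: W)
  have units: "\<nu> j \<in> E i \<and> norm (\<nu> j) = 1" if "j \<in> {j\<in>{1..m}. \<nu> j \<in> E i}" for j
    using that D(5) by blast
  obtain M f where "f ` {1..M} = {j\<in>{1..m}. \<nu> j \<in> E i}"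
    "polyhedral_description (E i) M (\<nu> \<circ> f) (b \<circ> f) (W i)"
    by (rule polyhedral_description_finite_index[OF _ E[OF i] nonempty bounded units W_eq minimal])
      simp_all
  then show "\<exists>M f. f ` {1..M} = {j\<in>{1..m}. \<nu> j \<in> E i} \<and>
      polyhedral_description (E i) M (\<nu> \<circ> f) (b \<circ> f) (W i)"
    by blast
qed

section \<open>Circumsolids\<close>

text \<open>Cauchy-Schwarz keeps the ball inside every half-space; its equality case makes
  \<open>x0 + R *\<^sub>R \<nu> j\<close> the only point of contact with face
  \<open>j\<close>.\<close>

lemma circumsolidI:
  assumes desc: "polyhedral_description E m \<nu> b \<Omega>" and "x0 \<in> E" "0 < R"
    and b: "\<And>j. j \<in> {1..m} \<Longrightarrow> b j = x0 \<bullet> \<nu> j + R"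
  shows "circumsolid E x0 R \<Omega>"
proof -
  note D = polyhedral_descriptionD[OF desc]
  have touch: "x \<bullet> \<nu> j \<le> b j" if "dist x0 x \<le> R" "j \<in> {1..m}" for x j
    using Cauchy_Schwarz_ineq2[of "x - x0" "\<nu> j"] that b D(5)
    by (auto simp: inner_simps dist_norm norm_minus_commute)
  have "ball x0 R \<inter> E \<subseteq> closure \<Omega>"
    using touch by (auto simp: closure_polyhedral[OF desc])
  moreover have "\<exists>!p. p \<in> (sphere x0 R \<inter> E) \<inter> polyhedral_face \<Omega> (\<nu> j) (b j)" if j: "j \<in> {1..m}" for j
  proof (rule ex1I)
    have unit: "\<nu> j \<bullet> \<nu> j = 1"
      using D(5)[OF j] by (simp add: norm_eq_1)
    have "dist x0 (x0 + R *\<^sub>R \<nu> j) = R" "x0 + R *\<^sub>R \<nu> j \<in> E"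
      using D(1,4,5) j assms by (auto simp: dist_norm subspace_add subspace_scale)
    moreover have "(x0 + R *\<^sub>R \<nu> j) \<bullet> \<nu> j = b j"
      using unit b[OF j] by (simp add: inner_simps)
    ultimately show "x0 + R *\<^sub>R \<nu> j \<in> (sphere x0 R \<inter> E) \<inter> polyhedral_face \<Omega> (\<nu> j) (b j)"
      using touch by (auto simp: polyhedral_face_def closure_polyhedral[OF desc])
    fix p assume p: "p \<in> (sphere x0 R \<inter> E) \<inter> polyhedral_face \<Omega> (\<nu> j) (b j)"
    then have "(p - x0) \<bullet> (p - x0) = R\<^sup>2"
      by (auto simp: dist_norm norm_minus_commute simp flip: power2_norm_eq_inner)
    moreover have "(p - x0) \<bullet> \<nu> j = R"
      using p b[OF j] by (simp add: polyhedral_face_def inner_simps)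
    \<comment> \<open>The square expands to
      \<open>R\<^sup>2 - 2 * R * R + R\<^sup>2\<close>.\<close>
    ultimately have "(p - x0 - R *\<^sub>R \<nu> j) \<bullet> (p - x0 - R *\<^sub>R \<nu> j) = 0"
      using unit
      by (simp add: inner_diff_left[of "p - x0" "R *\<^sub>R \<nu> j"] inner_diff_right[of _ "p - x0" "R *\<^sub>R \<nu> j"]
          inner_commute[of "\<nu> j" "p - x0"] power2_eq_square)
    then have "p - x0 - R *\<^sub>R \<nu> j = 0"
      by (simp only: inner_eq_zero_iff)
    then show "p = x0 + R *\<^sub>R \<nu> j"
      by (simp add: algebra_simps)
  qed
  ultimately show ?thesis
    unfolding circumsolid_def using assms by blast
qed

text \<open>The point of contact bounds the distance of face \<open>j\<close> from \<open>x0\<close>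
  above by \<open>R\<close>, by Cauchy-Schwarz; the ball contained in the closure bounds it
  below.\<close>

lemma circumsolidE:
  assumes "circumsolid E x0 R \<Omega>"
  obtains m \<nu> b where "polyhedral_description E m \<nu> b \<Omega>" "x0 \<in> E" "0 < R"
    "\<And>j. j \<in> {1..m} \<Longrightarrow> b j = x0 \<bullet> \<nu> j + R"
proof -
  obtain m \<nu> b where desc: "polyhedral_description E m \<nu> b \<Omega>" and x0: "x0 \<in> E" "0 < R"
    and ball: "ball x0 R \<inter> E \<subseteq> closure \<Omega>"
    and faces: "\<And>j. j \<in> {1..m} \<Longrightarrow> \<exists>p. p \<in> (sphere x0 R \<inter> E) \<inter> polyhedral_face \<Omega> (\<nu> j) (b j)"
    using assms unfolding circumsolid_def by (metis (no_types))
  note D = polyhedral_descriptionD[OF desc]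
  have "b j = x0 \<bullet> \<nu> j + R" if j: "j \<in> {1..m}" for j
  proof (rule antisym)
    obtain p where "dist x0 p = R" "p \<bullet> \<nu> j = b j"
      using faces[OF j] by (auto simp: polyhedral_face_def)
    then show "b j \<le> x0 \<bullet> \<nu> j + R"
      using Cauchy_Schwarz_ineq2[of "p - x0" "\<nu> j"] D(5)[OF j]
      by (auto simp: inner_simps dist_norm norm_minus_commute)
    have unit: "\<nu> j \<bullet> \<nu> j = 1"
      using D(5)[OF j] by (simp add: norm_eq_1)
    \<comment> \<open>The ball is open, so points at distance \<open>t < R\<close> along the normal
      are tested and \<open>t\<close> then tends to \<open>R\<close>.\<close>
    have "t \<le> b j - x0 \<bullet> \<nu> j" if "0 < t" "t < R" for t
    proof -
      have "x0 + t *\<^sub>R \<nu> j \<in> ball x0 R \<inter> E"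
        using that x0 D(1,4,5) j by (auto simp: dist_norm subspace_add subspace_scale)
      then have "(x0 + t *\<^sub>R \<nu> j) \<bullet> \<nu> j \<le> b j"
        using ball j by (auto simp: closure_polyhedral[OF desc])
      then show ?thesis
        using unit by (simp add: inner_simps)
    qed
    then have "R \<le> b j - x0 \<bullet> \<nu> j"
      using x0(2) dense_le_bounded by blast
    then show "x0 \<bullet> \<nu> j + R \<le> b j"
      by simp
  qed
  then show thesis
    using that desc x0 by blast
qed

section \<open>The overdetermined problem\<close>

theorem proposition8p1:
  fixes v :: "real ^ 'd \<Rightarrow> real"
    and H :: "real ^ 'd ^ 'd"
    and k :: nat and lam :: "nat \<Rightarrow> real" and E :: "nat \<Rightarrow> (real ^ 'd) set"
    and \<Omega> :: "(real ^ 'd) set" and m :: nat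
    and \<nu> :: "nat \<Rightarrow> real ^ 'd" and b :: "nat \<Rightarrow> real"
    and \<Sigma> :: "nat \<Rightarrow> (real ^ 'd) set"
  assumes v: "quadratic_function v"
    and H: "\<And>x. hessian v x = H"
    and lam_distinct: "inj_on lam {1..k}"
    and lam_eigenvalues: "lam ` {1..k} = eigenvalues H"
    and E: "\<And>i. i \<in> {1..k} \<Longrightarrow> E i = eigenspace H (lam i)"
    and \<Omega>: "polyhedral_description UNIV m \<nu> b \<Omega>"
    and \<Sigma>: "\<And>j. j \<in> {1..m} \<Longrightarrow> \<Sigma> j = polyhedral_face \<Omega> (\<nu> j) (b j)"
  shows
    "((\<exists>(\<mu>::real) (\<gamma>::nat \<Rightarrow> real).
          (\<forall>x\<in>\<Omega>. laplacian v x + \<mu> = 0) \<and>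
          (\<forall>j\<in>{1..m}. \<forall>x\<in>\<Sigma> j. dir_deriv (\<nu> j) v x + \<gamma> j = 0))
      \<longleftrightarrow>
      (\<exists>W. (\<forall>i\<in>{1..k}. convex_polyhedral_domain (E i) (W i)) \<and>
           \<Omega> = {x. \<forall>i\<in>{1..k}. orth_proj (E i) x \<in> W i}))
     \<and>
     ((\<exists>\<mu>::real.
          (\<forall>x\<in>\<Omega>. laplacian v x + \<mu> = 0) \<and>
          (\<forall>x\<in>frontier \<Omega>. \<forall>j\<in>{1..m}. x \<in> \<Sigma> j \<longrightarrow> dir_deriv (\<nu> j) v x = -1))
      \<longleftrightarrow>
      (\<exists>W. (\<forall>i\<in>{1..k}. convex_polyhedral_domain (E i) (W i)) \<and>
           \<Omega> = {x. \<forall>i\<in>{1..k}. orth_proj (E i) x \<in> W i} \<and>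
           (\<forall>i\<in>{1..k}. lam i < 0 \<and>
              (\<exists>p. is_arg_max v (\<lambda>x. x \<in> E i) p \<and> circumsolid (E i) p (- 1 / lam i) (W i)))))"
proof -

  \<comment> \<open>Gradient of v, eigenspaces and face normals\<close>
  obtain g where
    expand: "\<And>x n t. v (x + t *\<^sub>R n) = v x + t * ((H *v x + g) \<bullet> n) + t\<^sup>2 * (n \<bullet> (H *v n) / 2)"
    and sym: "\<And>x y. (H *v x) \<bullet> y = x \<bullet> (H *v y)"
    using quadratic_function_expansion[OF v H] by blast
  have grad: "dir_deriv n v x = x \<bullet> (H *v n) + g \<bullet> n" for n x
    using dir_deriv_of_expansion[OF expand] by (simp add: inner_add_left sym)
  have grad_eigen: "dir_deriv n v x = lam i * (x \<bullet> n) + g \<bullet> n" if "i \<in> {1..k}" "n \<in> E i" for n x i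
    using that by (simp add: grad E eigenspace_def)
  note D = polyhedral_descriptionD[OF \<Omega>]
  \<comment> \<open>The Laplacian is the trace of a constant Hessian, so all content lies in the
    boundary condition.\<close>
  have laplacian: "\<exists>\<mu>. \<forall>x\<in>\<Omega>. laplacian v x + \<mu> = 0"
    by (intro exI[of _ "- (\<Sum>i\<in>UNIV. H $ i $ i)"]) (simp add: laplacian_eq_trace_hessian H)
  have subspace_E: "subspace (E i)" if "i \<in> {1..k}" for i
    using that by (simp add: E subspace_eigenspace)
  have orth_E: "x \<bullet> y = 0" if "i \<in> {1..k}" "i' \<in> {1..k}" "i \<noteq> i'" "x \<in> E i" "y \<in> E i'" for i i' x y
    using that orthogonal_eigenspaces[OF sym, of x "lam i" y "lam i'"] inj_onD[OF lam_distinct]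
    by (auto simp: E)
  have face_D: "x \<bullet> \<nu> j = b j" if "x \<in> \<Sigma> j" "j \<in> {1..m}" for x j
    using that by (simp add: \<Sigma> polyhedral_face_def)
  \<comment> \<open>By \<open>grad\<close>, the Neumann condition makes
    \<open>x \<bullet> (H *v \<nu> j)\<close> constant on the face, so \<open>H *v \<nu> j\<close>
    is parallel to \<open>\<nu> j\<close>.\<close>
  have normal_eigen: "\<exists>i\<in>{1..k}. \<nu> j \<in> E i"
    if j: "j \<in> {1..m}" and neumann: "\<forall>x\<in>\<Sigma> j. dir_deriv (\<nu> j) v x + \<gamma> = 0" for j \<gamma>
  proof -
    have "x \<bullet> (H *v \<nu> j) = - \<gamma> - g \<bullet> \<nu> j" if "x \<in> polyhedral_face \<Omega> (\<nu> j) (b j)" for x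
    proof -
      have "dir_deriv (\<nu> j) v x + \<gamma> = 0"
        using neumann that \<Sigma>[OF j] by blast
      then show ?thesis
        by (simp add: grad)
    qed
    then have eigen: "H *v \<nu> j = ((H *v \<nu> j) \<bullet> \<nu> j) *\<^sub>R \<nu> j"
      by (rule normal_constant_on_facet[OF \<Omega> j])
    moreover have "\<nu> j \<noteq> 0"
      using D(5)[OF j] by auto
    ultimately have "(H *v \<nu> j) \<bullet> \<nu> j \<in> lam ` {1..k}"
      unfolding lam_eigenvalues eigenvalues_def by blast
    then show ?thesis
      using eigen E by (auto simp: eigenspace_def)
  qed
  define W where "W i = {y \<in> E i. \<forall>j\<in>{1..m}. \<nu> j \<in> E i \<longrightarrow> y \<bullet> \<nu> j < b j}" for i
  \<comment> \<open>Conditional on the normals being eigenvectors, since each of the two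
    equivalences derives that from its own boundary condition.\<close>
  have split: "\<Omega> = {x. \<forall>i\<in>{1..k}. orth_proj (E i) x \<in> W i}"
      and factor: "\<And>i. i \<in> {1..k} \<Longrightarrow> \<exists>M f. f ` {1..M} = {j\<in>{1..m}. \<nu> j \<in> E i} \<and>
        polyhedral_description (E i) M (\<nu> \<circ> f) (b \<circ> f) (W i)"
    if "\<And>j. j \<in> {1..m} \<Longrightarrow> \<exists>i\<in>{1..k}. \<nu> j \<in> E i"
    by (rule product_of_factors[OF \<Omega> _ _ _ W_def] polyhedral_factor[OF \<Omega> _ _ _ W_def, where I = "{1..k}"];
        (rule subspace_E orth_E that | assumption)+)+

  \<comment> \<open>Constant normal derivative on each face and the product structure\<close>
  have "(\<exists>(\<mu>::real) (\<gamma>::nat \<Rightarrow> real). (\<forall>x\<in>\<Omega>. laplacian v x + \<mu> = 0) \<and>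
          (\<forall>j\<in>{1..m}. \<forall>x\<in>\<Sigma> j. dir_deriv (\<nu> j) v x + \<gamma> j = 0))
      \<longleftrightarrow> (\<exists>W. (\<forall>i\<in>{1..k}. convex_polyhedral_domain (E i) (W i)) \<and>
           \<Omega> = {x. \<forall>i\<in>{1..k}. orth_proj (E i) x \<in> W i})" (is "?L1 \<longleftrightarrow> ?R1")
  proof
    assume ?L1
    then have "\<And>j. j \<in> {1..m} \<Longrightarrow> \<exists>i\<in>{1..k}. \<nu> j \<in> E i"
      using normal_eigen by metis
    from split[OF this] factor[OF this] show ?R1
      unfolding convex_polyhedral_domain_def by blast
  next
    assume ?R1
    then obtain W where W: "\<And>i. i \<in> {1..k} \<Longrightarrow> convex_polyhedral_domain (E i) (W i)"
      and prod: "\<Omega> = {x. \<forall>i\<in>{1..k}. orth_proj (E i) x \<in> W i}"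
      by blast
    then obtain M n c where
      desc: "\<And>i. i \<in> {1..k} \<Longrightarrow> polyhedral_description (E i) (M i) (n i) (c i) (W i)"
      unfolding convex_polyhedral_domain_def by metis
    have "\<exists>\<gamma>. \<forall>x\<in>\<Sigma> j. dir_deriv (\<nu> j) v x + \<gamma> = 0" if j: "j \<in> {1..m}" for j
    proof -
      obtain i l where "i \<in> {1..k}" "l \<in> {1..M i}" "\<nu> j = n i l"
        using facet_normal_of_product[OF \<Omega> j desc prod] by metis
      then have "i \<in> {1..k}" "\<nu> j \<in> E i"
        using polyhedral_descriptionD(4)[OF desc] by auto
      \<comment> \<open>For an eigenvector normal the derivative sees \<open>x\<close> only through
        \<open>x \<bullet> \<nu> j\<close>, which equals \<open>b j\<close> on the face.\<close>
      then show ?thesis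
        using face_D[OF _ j] grad_eigen
        by (intro exI[of _ "- (lam i * b j + g \<bullet> \<nu> j)"]) simp
    qed
    then show ?L1
      using laplacian by metis
  qed

  \<comment> \<open>Normal derivative -1 and circumsolid factors\<close>
  moreover have "(\<exists>\<mu>::real. (\<forall>x\<in>\<Omega>. laplacian v x + \<mu> = 0) \<and>
          (\<forall>x\<in>frontier \<Omega>. \<forall>j\<in>{1..m}. x \<in> \<Sigma> j \<longrightarrow> dir_deriv (\<nu> j) v x = -1))
      \<longleftrightarrow> (\<exists>W. (\<forall>i\<in>{1..k}. convex_polyhedral_domain (E i) (W i)) \<and>
           \<Omega> = {x. \<forall>i\<in>{1..k}. orth_proj (E i) x \<in> W i} \<and>
           (\<forall>i\<in>{1..k}. lam i < 0 \<and>
              (\<exists>p. is_arg_max v (\<lambda>x. x \<in> E i) p \<and> circumsolid (E i) p (- 1 / lam i) (W i))))"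
    (is "?L2 \<longleftrightarrow> ?R2")
  proof
    assume ?L2
    \<comment> \<open>Faces lie in the frontier: their points belong to the closure but violate a
      strict inequality.\<close>
    have neumann: "dir_deriv (\<nu> j) v x = -1" if j: "j \<in> {1..m}" and x: "x \<in> \<Sigma> j" for j x
    proof -
      have "x \<notin> \<Omega>"
        using face_D[OF x j] polyhedral_memD[OF \<Omega> _ j, of x] by auto
      then have "x \<in> frontier \<Omega>"
        using x \<Sigma>[OF j] interior_subset by (auto simp: frontier_def polyhedral_face_def)
      then show ?thesis
        using \<open>?L2\<close> j x by blast
    qed
    have normals: "\<exists>i\<in>{1..k}. \<nu> j \<in> E i" if "j \<in> {1..m}" for j
      by (rule normal_eigen[OF that, of 1]) (use neumann[OF that] in simp)
    \<comment> \<open>Evaluating at a point of the face, which is nonempty, turns the boundary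
      condition into an equation for \<open>b j\<close>.\<close>
    have offset: "lam i * b j + g \<bullet> \<nu> j = -1" if i: "i \<in> {1..k}" and j: "j \<in> {1..m}" and "\<nu> j \<in> E i" for i j
    proof -
      obtain x where x: "x \<bullet> \<nu> j = b j" "\<And>l. l \<in> {1..m} - {j} \<Longrightarrow> x \<bullet> \<nu> l < b l"
        using facet_point[OF \<Omega> j] by metis
      then have "x \<in> \<Sigma> j"
        unfolding \<Sigma>[OF j] by (intro polyhedral_faceI[OF \<Omega>]) auto
      then show ?thesis
        using neumann[OF j, of x] grad_eigen[OF i \<open>\<nu> j \<in> E i\<close>, of x] x(1) by simp
    qed
    have "lam i < 0 \<and> (\<exists>p. is_arg_max v (\<lambda>x. x \<in> E i) p \<and> circumsolid (E i) p (- 1 / lam i) (W i))"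
      if i: "i \<in> {1..k}" for i
    proof -
      obtain M f where f: "f ` {1..M} = {j\<in>{1..m}. \<nu> j \<in> E i}"
        and desc: "polyhedral_description (E i) M (\<nu> \<circ> f) (b \<circ> f) (W i)"
        using factor[OF normals i] by blast
      have index: "f l \<in> {1..m}" "\<nu> (f l) \<in> E i" if "l \<in> {1..M}" for l
        using f that by blast+
      note DW = polyhedral_descriptionD[OF desc]
      note proj = orth_proj[OF subspace_E[OF i]]
      define gi where "gi = orth_proj (E i) g"
      have gi: "gi \<in> E i" "\<And>z. z \<in> E i \<Longrightarrow> g \<bullet> z = gi \<bullet> z"
        by (auto simp: gi_def proj)
      have lam_neg: "lam i < 0"
      proof (rule ccontr)
        assume "\<not> lam i < 0"
        then have lam_ge: "0 \<le> lam i"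
          by simp
        obtain y where y: "y \<in> W i"
          using DW(2) by blast
        \<comment> \<open>The gradient at \<open>y\<close> of \<open>v\<close> restricted to
          \<open>E i\<close>. For \<open>lam i \<ge> 0\<close> its product with each normal is at
          most the left side of \<open>offset\<close>, that is -1.\<close>
        let ?w = "lam i *\<^sub>R y + gi"
        have w: "?w \<bullet> \<nu> (f l) \<le> -1" if l: "l \<in> {1..M}" for l
        proof -
          have "y \<bullet> \<nu> (f l) \<le> b (f l)"
            using polyhedral_memD[OF desc y l] by simp
          then have "lam i * (y \<bullet> \<nu> (f l)) \<le> lam i * b (f l)"
            using lam_ge by (rule mult_left_mono)
          then show ?thesis
            using offset[OF i index(1)[OF l] index(2)[OF l]] gi(2)[OF index(2)[OF l]]
            by (simp add: inner_add_left)
        qed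
        have "?w \<in> E i"
          using y gi(1) DW(1,6) by (auto intro: subspace_add subspace_scale)
        then have "?w = 0"
          by (rule no_recession_direction[OF desc]) (use w in force)
        \<comment> \<open>The zero vector cannot have product at most -1 with a normal, so there are
          no normals. Then every vector of \<open>E i\<close> is a recession direction, in
          particular a nonzero eigenvector.\<close>
        then have empty: "{1..M} = {}"
          using w by fastforce
        obtain z where "z \<noteq> 0" "z \<in> E i"
          using lam_eigenvalues i E[OF i] by (force simp: eigenvalues_def eigenspace_def)
        then show False
          using no_recession_direction[OF desc \<open>z \<in> E i\<close>] empty by blast
      qed
      \<comment> \<open>The critical point of \<open>v\<close> restricted to \<open>E i\<close>.
        Expanding there leaves only the term \<open>lam i * ((y - p) \<bullet> (y - p)) / 2\<close>,
        so \<open>p\<close> is a maximum.\<close>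
      define p where "p = (- 1 / lam i) *\<^sub>R gi"
      have p: "p \<in> E i" "lam i *\<^sub>R p + gi = 0"
        using gi(1) subspace_E[OF i] lam_neg by (auto simp: p_def subspace_scale subspace_neg)
      have "v y \<le> v p" if y: "y \<in> E i" for y
      proof -
        have "y - p \<in> E i"
          using y p subspace_E[OF i] by (auto intro: subspace_diff)
        then have "(H *v p + g) \<bullet> (y - p) = (lam i *\<^sub>R p + gi) \<bullet> (y - p)"
          and "H *v (y - p) = lam i *\<^sub>R (y - p)"
          using p(1) E[OF i] gi(2) by (auto simp: eigenspace_def inner_add_left)
        then have "v y = v p + lam i * ((y - p) \<bullet> (y - p)) / 2"
          using expand[of p 1 "y - p"] p(2) by simp
        moreover have "lam i * ((y - p) \<bullet> (y - p)) \<le> 0"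
          using lam_neg by (simp add: mult_nonpos_nonneg)
        ultimately show ?thesis
          by simp
      qed
      then have "is_arg_max v (\<lambda>x. x \<in> E i) p"
        using p(1) by (auto simp: is_arg_max_def not_less)
      \<comment> \<open>This is \<open>offset\<close> divided by \<open>lam i\<close>.\<close>
      moreover have "(b \<circ> f) l = p \<bullet> (\<nu> \<circ> f) l + - 1 / lam i" if l: "l \<in> {1..M}" for l
        using offset[OF i index(1)[OF l] index(2)[OF l]] gi(2)[OF index(2)[OF l]] lam_neg
        by (simp add: p_def field_simps)
      then have "circumsolid (E i) p (- 1 / lam i) (W i)"
        using lam_neg by (intro circumsolidI[OF desc p(1)]) (simp_all add: divide_neg_neg)
      ultimately show ?thesis
        using lam_neg by blast
    qed
    moreover have "\<forall>i\<in>{1..k}. convex_polyhedral_domain (E i) (W i)"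
      using factor[OF normals] unfolding convex_polyhedral_domain_def by blast
    ultimately show ?R2
      using split[OF normals] by blast
  next
    assume ?R2
    then obtain W where prod: "\<Omega> = {x. \<forall>i\<in>{1..k}. orth_proj (E i) x \<in> W i}"
      and W: "\<forall>i\<in>{1..k}. lam i < 0 \<and>
        (\<exists>p. is_arg_max v (\<lambda>x. x \<in> E i) p \<and> circumsolid (E i) p (- 1 / lam i) (W i))"
      by (elim exE conjE)
    then have lam_neg: "\<And>i. i \<in> {1..k} \<Longrightarrow> lam i < 0"
      by blast
    from W have "\<forall>i\<in>{1..k}. \<exists>p. is_arg_max v (\<lambda>x. x \<in> E i) p \<and> circumsolid (E i) p (- 1 / lam i) (W i)"
      by blast
    from bchoice[OF this] obtain p
      where p_max: "\<And>i. i \<in> {1..k} \<Longrightarrow> is_arg_max v (\<lambda>x. x \<in> E i) (p i)"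
      and circ: "\<And>i. i \<in> {1..k} \<Longrightarrow> circumsolid (E i) (p i) (- 1 / lam i) (W i)"
      by blast
    have "\<exists>M n c. polyhedral_description (E i) M n c (W i) \<and>
        (\<forall>l\<in>{1..M}. c l = p i \<bullet> n l + - 1 / lam i)" if "i \<in> {1..k}" for i
      using circumsolidE[OF circ[OF that]] by metis
    then obtain M n c where
      desc: "\<And>i. i \<in> {1..k} \<Longrightarrow> polyhedral_description (E i) (M i) (n i) (c i) (W i)"
      and c: "\<And>i l. \<lbrakk>i \<in> {1..k}; l \<in> {1..M i}\<rbrakk> \<Longrightarrow> c i l = p i \<bullet> n i l + - 1 / lam i"
      by metis
    \<comment> \<open>The line through \<open>p i\<close> in direction \<open>u\<close> stays in
      \<open>E i\<close>, so \<open>v\<close> along it is maximal at \<open>t = 0\<close>.\<close>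
    have critical: "dir_deriv u v (p i) = 0" if i: "i \<in> {1..k}" and u: "u \<in> E i" for i u
    proof -
      have "v (p i + t *\<^sub>R u) \<le> v (p i)" for t
        using p_max[OF i] u subspace_E[OF i]
        by (auto simp: is_arg_max_def not_less subspace_add subspace_scale)
      moreover have "((\<lambda>t. v (p i + t *\<^sub>R u)) has_real_derivative (H *v p i + g) \<bullet> u) (at 0)"
        unfolding expand by (auto intro!: derivative_eq_intros)
      ultimately have "(H *v p i + g) \<bullet> u = 0"
        using DERIV_local_max[of "\<lambda>t. v (p i + t *\<^sub>R u)" _ 0 1] by simp
      then show ?thesis
        using dir_deriv_of_expansion[OF expand] by simp
    qed
    have "dir_deriv (\<nu> j) v x = -1" if j: "j \<in> {1..m}" and x: "x \<in> \<Sigma> j" for j x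
    proof -
      obtain i l where i: "i \<in> {1..k}" and l: "l \<in> {1..M i}" and eq: "\<nu> j = n i l" "b j = c i l"
        using facet_normal_of_product[OF \<Omega> j desc prod] by metis
      then have \<nu>: "\<nu> j \<in> E i"
        using polyhedral_descriptionD(4)[OF desc] by auto
      \<comment> \<open>Going from \<open>p i\<close> to the face changes the derivative by
        \<open>lam i\<close> times the distance \<open>- 1 / lam i\<close>, that is by -1.\<close>
      have "dir_deriv (\<nu> j) v x = lam i * (p i \<bullet> \<nu> j + - 1 / lam i) + g \<bullet> \<nu> j"
        using grad_eigen[OF i \<nu>] face_D[OF x j] c[OF i l] eq by simp
      also have "\<dots> = dir_deriv (\<nu> j) v (p i) - 1"
        using grad_eigen[OF i \<nu>] lam_neg[OF i] by (simp add: algebra_simps)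
      finally show ?thesis
        using critical[OF i \<nu>] by simp
    qed
    then show ?L2
      using laplacian by blast
  qed
  ultimately show ?thesis
    by blast
qed

end
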